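(* Let $Q_n$ be the $n$-dimensional hypercube graph. Then $\mathrm{ILN}(Q_n) < n + O(\log n)$ as $n\to\infty$; that is, there exist constants $C>0$ and $n_0$ such that $\mathrm{ILN}(Q_n) < n + C\log n$ for all $n\ge n_0$.
   Context: Graphs are finite, simple and undirected. The hypercube $Q_n$ has the $2^n$ subsets of $\{1,\dots,n\}$ as vertices, two being adjacent when their symmetric difference has exactly one element. A valid labelling of a graph $G$ assigns to the vertices of $G$ pairwise distinct nonempty finite sets (labels) such that two distinct vertices are adjacent if and only if their labels are disjoint. The individual label number $\mathrm{ILN}(G)$ is the minimum, over all valid labellings of $G$, of the maximum cardinality of a vertex label. *)

theory Defs
  imports Complex_Main
begin

text \<open>A graph is given by its vertex set and its set of two-element edges.\<close>

definition simple_graph :: "'a set \<Rightarrow> 'a set set \<Rightarrow> bool" where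
  "simple_graph V E \<longleftrightarrow> finite V \<and> (\<forall>e\<in>E. e \<subseteq> V \<and> card e = 2)"

text \<open>Labels are sets of natural numbers.  Only finitely many finite labels occur in a labelling
  of a finite graph, so labels over any other universe can be renamed to these.\<close>

definition valid_labelling :: "'a set \<Rightarrow> 'a set set \<Rightarrow> ('a \<Rightarrow> nat set) \<Rightarrow> bool" where
  "valid_labelling V E L \<longleftrightarrow>
     inj_on L V \<and>
     (\<forall>v\<in>V. finite (L v) \<and> L v \<noteq> {}) \<and>
     (\<forall>u\<in>V. \<forall>v\<in>V. u \<noteq> v \<longrightarrow> ({u, v} \<in> E \<longleftrightarrow> L u \<inter> L v = {}))"

definition max_label_size :: "'a set \<Rightarrow> ('a \<Rightarrow> nat set) \<Rightarrow> nat" where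
  "max_label_size V L = Max ((\<lambda>v. card (L v)) ` V)"

text \<open>The set over which the minimum is taken is nonempty; see \<open>valid_labelling_exists\<close> below.\<close>

definition ILN :: "'a set \<Rightarrow> 'a set set \<Rightarrow> nat" where
  "ILN V E = (LEAST k. \<exists>L. valid_labelling V E L \<and> max_label_size V L = k)"

definition hypercube_verts :: "nat \<Rightarrow> nat set set" where
  "hypercube_verts n = Pow {1..n}"

definition hypercube_edges :: "nat \<Rightarrow> nat set set set" where
  "hypercube_edges n =
     {{A, B} | A B. A \<in> hypercube_verts n \<and> B \<in> hypercube_verts n \<and> card (sym_diff A B) = 1}"

lemma simple_graph_hypercube: "simple_graph (hypercube_verts n) (hypercube_edges n)"
proof -
  have "card {A, B} = 2" if "card (sym_diff A B) = 1" for A B :: "nat set"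
  proof -
    have "A \<noteq> B" using that by auto
    then show ?thesis by simp
  qed
  then show ?thesis
    by (fastforce simp: simple_graph_def hypercube_verts_def hypercube_edges_def)
qed

lemma valid_labelling_exists:
  assumes "simple_graph V E"
  shows "\<exists>L. valid_labelling V E L"
proof -
  have fin: "finite V" using assms by (simp add: simple_graph_def)
  define N where "N v = {e. \<exists>u\<in>V. e = {u, v} \<and> {u, v} \<notin> E}" for v
  have "finite (Pow V)" using fin by simp
  then obtain f :: "'a set \<Rightarrow> nat" where f: "inj_on f (Pow V)"
    using finite_imp_inj_to_nat_seg by blast
  have sing: "{v} \<notin> E" for v using assms by (auto simp: simple_graph_def)
  have sub: "N v \<subseteq> Pow V" if "v \<in> V" for v using that by (auto simp: N_def)
  have self: "{v} \<in> N v" if "v \<in> V" for v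
    using that sing[of v] by (auto simp: N_def)
  have other: "{v} \<notin> N u" if "u \<noteq> v" for u v using that by (auto simp: N_def)
  have inter: "N u \<inter> N v = {} \<longleftrightarrow> {u, v} \<in> E" if "u \<in> V" "v \<in> V" "u \<noteq> v" for u v
  proof
    assume e: "N u \<inter> N v = {}"
    show "{u, v} \<in> E"
    proof (rule ccontr)
      assume "{u, v} \<notin> E"
      then have "{v, u} \<in> N u" "{u, v} \<in> N v"
        using that by (auto simp: N_def insert_commute)
      then show False using e by (auto simp: insert_commute)
    qed
  next
    assume "{u, v} \<in> E"
    then show "N u \<inter> N v = {}"
      using that by (auto simp: N_def doubleton_eq_iff insert_commute)
  qed
  have "valid_labelling V E (\<lambda>v. f ` N v)"
    unfolding valid_labelling_def
  proof (intro conjI ballI impI)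
    show "inj_on (\<lambda>v. f ` N v) V"
    proof (rule inj_onI)
      fix u v assume uv: "u \<in> V" "v \<in> V" "f ` N u = f ` N v"
      then have "N u = N v" using inj_on_image_eq_iff[OF f sub sub] by blast
      then show "u = v" using self[OF uv(2)] other by blast
    qed
  next
    fix v assume v: "v \<in> V"
    show "finite (f ` N v)"
      using finite_subset[OF sub[OF v] \<open>finite (Pow V)\<close>] by simp
    show "f ` N v \<noteq> {}" using self[OF v] by blast
  next
    fix u v assume uv: "u \<in> V" "v \<in> V" "u \<noteq> v"
    have "f ` N u \<inter> f ` N v = f ` (N u \<inter> N v)"
      using inj_on_image_Int[OF f sub[OF uv(1)] sub[OF uv(2)]] by simp
    then show "({u, v} \<in> E) = (f ` N u \<inter> f ` N v = {})"
      using inter[OF uv] by simp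
  qed
  then show ?thesis by blast
qed

end

theory Submission
  imports Defs "HOL-Library.Countable"
begin

text \<open>Let \<open>D\<close> be the symmetric difference of two vertices of opposite parity. They are non-adjacent
  iff \<open>D\<close> has at least two elements, that is, iff some \<open>i \<in> D\<close> (for instance the second smallest
  element) has an odd number of elements of \<open>D\<close> below it. In terms of the vertices, this says that
  they differ both in coordinate \<open>i\<close> and in the parity of the coordinates before \<open>i\<close>. So it suffices
  that every vertex records these two bits for each \<open>i\<close>, with both bits negated at odd vertices. One
  more element, the parity of the vertex, makes labels of vertices of equal parity intersect; this
  gives labels of size \<open>n + 1\<close>.\<close>

lemma odd_card_sym_diff:
  assumes "finite A" "finite B"
  shows "odd (card (sym_diff A B)) \<longleftrightarrow> odd (card A) \<noteq> odd (card B)"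
proof -
  have "card A = card (A - B) + card (A \<inter> B)" "card B = card (B - A) + card (A \<inter> B)"
    using card_Int_Diff[OF assms(1), of B] card_Int_Diff[OF assms(2), of A]
    by (simp_all add: Int_commute)
  moreover have "card (sym_diff A B) = card (A - B) + card (B - A)"
    using assms by (intro card_Un_disjoint) auto
  ultimately show ?thesis by auto
qed

text \<open>In a singleton nothing lies below the only element. Otherwise the second smallest
  element has exactly one element of \<open>D\<close> below it, namely the minimum.\<close>

lemma ex_odd_card_below_iff:
  fixes D :: "'a::linorder set"
  assumes "finite D" "D \<noteq> {}"
  shows "(\<exists>i\<in>D. odd (card (D \<inter> {..<i}))) \<longleftrightarrow> card D \<noteq> 1"
proof
  assume "\<exists>i\<in>D. odd (card (D \<inter> {..<i}))"
  then show "card D \<noteq> 1" by (auto simp: card_1_singleton_iff)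
next
  assume card: "card D \<noteq> 1"
  define m where "m = Min D"
  define i where "i = Min (D - {m})"
  have m: "m \<in> D" using assms by (simp add: m_def)
  have ne: "D - {m} \<noteq> {}"
  proof
    assume "D - {m} = {}"
    then have "D = {m}" using m by blast
    then show False using card by simp
  qed
  have i: "i \<in> D - {m}" unfolding i_def using assms ne by (intro Min_in) auto
  have "m \<le> i" unfolding m_def using assms i by (intro Min_le) auto
  then have "m < i" using i by auto
  moreover have "i \<le> j" if "j \<in> D - {m}" for j
    unfolding i_def using assms that by (intro Min_le) auto
  ultimately have "D \<inter> {..<i} = {m}" using m by fastforce
  then show "\<exists>i\<in>D. odd (card (D \<inter> {..<i}))" using i by (intro bexI[of _ i]) auto
qed

lemma hypercube_edge_iff:
  assumes "A \<in> hypercube_verts n" "B \<in> hypercube_verts n"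
  shows "{A, B} \<in> hypercube_edges n \<longleftrightarrow> card (sym_diff A B) = 1"
proof -
  have "sym_diff A B = sym_diff X Y" if "{A, B} = {X, Y}" for X Y
    using that unfolding doubleton_eq_iff by blast
  then have "card (sym_diff A B) = 1" if "{A, B} \<in> hypercube_edges n"
    using that unfolding hypercube_edges_def by fastforce
  moreover have "{A, B} \<in> hypercube_edges n" if "card (sym_diff A B) = 1"
    using that assms unfolding hypercube_edges_def by blast
  ultimately show ?thesis by blast
qed

text \<open>The first component keeps codes of different coordinates apart, so only codes with the
  same \<open>i\<close> can coincide.\<close>

definition cube_code :: "nat set \<Rightarrow> nat \<Rightarrow> nat \<times> bool \<times> bool" where
  "cube_code A i =
     (i, odd (card (A \<inter> {..<i})) \<noteq> odd (card A), (i \<in> A) \<noteq> odd (card A))"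

text \<open>Coordinates start at 1, so the index 0 is free to mark the parity element.\<close>

definition cube_label :: "nat \<Rightarrow> nat set \<Rightarrow> nat set" where
  "cube_label n A = to_nat ` insert (0, odd (card A), True) (cube_code A ` {1..n})"

text \<open>Since \<open>to_nat\<close> is injective, the sets may be intersected before encoding.
  The index tags then leave two possible kinds of common elements: the parity element, or codes of
  one and the same coordinate.\<close>

lemma cube_label_disjoint_iff:
  "cube_label n A \<inter> cube_label n B = {} \<longleftrightarrow>
     odd (card A) \<noteq> odd (card B) \<and> (\<forall>i\<in>{1..n}. cube_code A i \<noteq> cube_code B i)"
proof -
  have "cube_label n A \<inter> cube_label n B = to_nat `
      (insert (0, odd (card A), True) (cube_code A ` {1..n}) \<inter>
       insert (0, odd (card B), True) (cube_code B ` {1..n}))"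
    unfolding cube_label_def by (rule image_Int[symmetric]) simp
  then have "cube_label n A \<inter> cube_label n B = {} \<longleftrightarrow>
      insert (0, odd (card A), True) (cube_code A ` {1..n}) \<inter>
      insert (0, odd (card B), True) (cube_code B ` {1..n}) = {}"
    by (simp only: image_is_empty)
  moreover have "(0, b, c) \<notin> cube_code C ` {1..n}" for b c C
    by (auto simp: cube_code_def)
  moreover have "cube_code A ` {1..n} \<inter> cube_code B ` {1..n} = {} \<longleftrightarrow>
      (\<forall>i\<in>{1..n}. cube_code A i \<noteq> cube_code B i)"
  proof -
    have "i = j" if "cube_code A i = cube_code B j" for i j
      using that by (simp add: cube_code_def)
    then show ?thesis by blast
  qed
  ultimately show ?thesis by auto
qed

text \<open>Exactly one of the two vertices is odd, so exactly one code is negated, and the codes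
  agree iff both underlying bits differ. The prefix parities differ iff the symmetric difference has
  an odd number of elements below \<open>i\<close>.\<close>

lemma cube_code_eq_iff:
  assumes "finite A" "finite B" "odd (card A) \<noteq> odd (card B)"
  shows "cube_code A i = cube_code B i \<longleftrightarrow>
    i \<in> sym_diff A B \<and> odd (card (sym_diff A B \<inter> {..<i}))"
proof -
  have "sym_diff A B \<inter> {..<i} = sym_diff (A \<inter> {..<i}) (B \<inter> {..<i})" by auto
  then have "odd (card (sym_diff A B \<inter> {..<i})) \<longleftrightarrow>
      odd (card (A \<inter> {..<i})) \<noteq> odd (card (B \<inter> {..<i}))"
    using assms odd_card_sym_diff[of "A \<inter> {..<i}" "B \<inter> {..<i}"] by simp
  then show ?thesis using assms(3) by (auto simp: cube_code_def)
qed

lemma cube_label_adjacent_iff: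
  assumes "A \<subseteq> {1..n}" "B \<subseteq> {1..n}"
  shows "card (sym_diff A B) = 1 \<longleftrightarrow> cube_label n A \<inter> cube_label n B = {}"
proof -
  have fin: "finite A" "finite B" using assms finite_subset by blast+
  note parity = odd_card_sym_diff[OF fin]
  show ?thesis
  proof (cases "odd (card A) = odd (card B)")
    case True
    then have "even (card (sym_diff A B))" using parity by blast
    then have "card (sym_diff A B) \<noteq> 1" by (rule contrapos_pn) (simp only: odd_one simp_thms)
    then show ?thesis using True by (simp add: cube_label_disjoint_iff)
  next
    case False
    then have "odd (card (sym_diff A B))" using parity by blast
    \<comment> \<open>Oddness excludes the empty set, which \<open>ex_odd_card_below_iff\<close>
      does not cover.\<close>
    then have "sym_diff A B \<noteq> {}" by (rule contrapos_nn) (simp only: card.empty even_zero)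
    then have "card (sym_diff A B) = 1 \<longleftrightarrow>
        \<not> (\<exists>i\<in>sym_diff A B. odd (card (sym_diff A B \<inter> {..<i})))"
      using ex_odd_card_below_iff[of "sym_diff A B"] fin by blast
    also have "\<dots> \<longleftrightarrow> \<not> (\<exists>i\<in>{1..n}. cube_code A i = cube_code B i)"
      \<comment> \<open>The symmetric difference lies in \<open>{1..n}\<close>, so no witness
        \<open>i\<close> is lost.\<close>
      unfolding cube_code_eq_iff[OF fin False] using assms by blast
    finally show ?thesis using False by (simp add: cube_label_disjoint_iff)
  qed
qed

text \<open>The element with index 0 reveals the parity of the vertex; knowing it, the last bit of
  the code at \<open>i\<close> can be read as membership of \<open>i\<close>.\<close>

lemma inj_on_cube_label: "inj_on (cube_label n) (Pow {1..n})"
proof (rule inj_onI)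
  fix A B assume sub: "A \<in> Pow {1..n}" "B \<in> Pow {1..n}" and "cube_label n A = cube_label n B"
  then have eq: "insert (0, odd (card A), True) (cube_code A ` {1..n}) =
      insert (0, odd (card B), True) (cube_code B ` {1..n})"
    by (simp only: cube_label_def inj_image_eq_iff[OF inj_to_nat])
  then have "(0, odd (card A), True) \<in> insert (0, odd (card B), True) (cube_code B ` {1..n})"
    by (metis insertI1)
  then have parity: "odd (card A) = odd (card B)" by (auto simp: cube_code_def)
  have "i \<in> A \<longleftrightarrow> i \<in> B" if "i \<in> {1..n}" for i
  proof -
    have "cube_code A i \<in> insert (0, odd (card B), True) (cube_code B ` {1..n})"
      unfolding eq[symmetric] using that by (intro insertI2 imageI)
    then show ?thesis using that parity by (auto simp: cube_code_def)
  qed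
  then show "A = B" using sub by blast
qed

lemma valid_labelling_cube_label:
  "valid_labelling (hypercube_verts n) (hypercube_edges n) (cube_label n)"
  unfolding valid_labelling_def
proof (intro conjI ballI impI)
  show "inj_on (cube_label n) (hypercube_verts n)"
    using inj_on_cube_label by (simp add: hypercube_verts_def)
next
  fix A B assume "A \<in> hypercube_verts n" "B \<in> hypercube_verts n"
  then show "({A, B} \<in> hypercube_edges n) = (cube_label n A \<inter> cube_label n B = {})"
    using hypercube_edge_iff cube_label_adjacent_iff by (simp add: hypercube_verts_def)
qed (simp_all add: cube_label_def)

lemma card_cube_label_le: "card (cube_label n A) \<le> n + 1"
proof -
  have "card (cube_label n A) \<le> card (insert (0, odd (card A), True) (cube_code A ` {1..n}))"
    unfolding cube_label_def by (rule card_image_le) simp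
  also have "\<dots> \<le> Suc (card (cube_code A ` {1..n}))" by (simp add: card_insert_if)
  also have "\<dots> \<le> n + 1" using card_image_le[of "{1..n}" "cube_code A"] by simp
  finally show ?thesis .
qed

lemma ILN_le:
  assumes "valid_labelling V E L" "finite V" "V \<noteq> {}" "\<And>v. v \<in> V \<Longrightarrow> card (L v) \<le> k"
  shows "ILN V E \<le> k"
proof -
  have "ILN V E \<le> max_label_size V L"
    unfolding ILN_def using assms(1) by (intro Least_le) blast
  also have "\<dots> \<le> k"
    unfolding max_label_size_def using assms by simp
  finally show ?thesis .
qed

lemma ILN_hypercube_le: "ILN (hypercube_verts n) (hypercube_edges n) \<le> n + 1"
  by (rule ILN_le[OF valid_labelling_cube_label _ _ card_cube_label_le])
    (auto simp: hypercube_verts_def)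

theorem theorem30:
  "\<exists>C::real. C > 0 \<and> (\<exists>n0::nat. \<forall>n\<ge>n0.
     real (ILN (hypercube_verts n) (hypercube_edges n)) < real n + C * ln (real n))"
proof (intro exI conjI allI impI)
  \<comment> \<open>The bound 3 exceeds \<open>exp 1\<close>, so the logarithm is at least 1; the
    constant 2 instead of 1 then makes the inequality strict.\<close>
  fix n :: nat assume n: "3 \<le> n"
  then have "exp 1 \<le> real n" using exp_le by linarith
  then have "1 \<le> ln (real n)" using n by (simp add: ln_ge_iff)
  moreover have "real (ILN (hypercube_verts n) (hypercube_edges n)) \<le> real n + 1"
    using ILN_hypercube_le[of n] by linarith
  ultimately show "real (ILN (hypercube_verts n) (hypercube_edges n)) < real n + 2 * ln (real n)"
    by linarith
qed simp

end
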